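(* For every integer $n\ge 3$, the digraph $\overrightarrow{K_n}$ is a vertex-antimagic total digraph.
   Context: $\overrightarrow{K_n}$ is the directed graph with vertex set $V=\{v_1,\dots,v_n\}$ and arc set $E$ consisting of, for every pair $1\le i<j\le n$, exactly one arc directed from $v_i$ to $v_j$; $l=|E|=\binom n2$. A total labeling of a directed graph is a bijection $f:V\cup E\to\{1,2,\dots,n+l\}$. The vertex-weight of a vertex $v$ under $f$ is $w_f(v)=f(v)+S^-_v+S^+_v$, where $S^-_v$ is the sum of $f$ over arcs entering $v$ and $S^+_v$ the sum of $f$ over arcs leaving $v$. A total labeling is vertex-antimagic total if all vertex-weights are pairwise distinct, and a digraph is a vertex-antimagic total digraph if it admits such a labeling. *)

theory Defs
  imports "Graph_Theory.Digraph"
begin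

text \<open>
  A labeling of \<open>V \<union> E\<close> is a function on the disjoint sum of vertices and arcs:
  \<open>f (Inl v)\<close> is the label of the vertex \<open>v\<close>, \<open>f (Inr e)\<close> the label of the arc \<open>e\<close>.
  Values of \<open>f\<close> outside \<open>V \<union> E\<close> are irrelevant.
\<close>

definition total_labeling :: "('a, 'b) pre_digraph \<Rightarrow> ('a + 'b \<Rightarrow> nat) \<Rightarrow> bool" where
  "total_labeling G f \<longleftrightarrow>
     bij_betw f (verts G <+> arcs G) {1..card (verts G) + card (arcs G)}"

definition vertex_weight :: "('a, 'b) pre_digraph \<Rightarrow> ('a + 'b \<Rightarrow> nat) \<Rightarrow> 'a \<Rightarrow> nat" where
  "vertex_weight G f v =
     f (Inl v) + (\<Sum>e\<in>in_arcs G v. f (Inr e)) + (\<Sum>e\<in>out_arcs G v. f (Inr e))"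

definition vertex_antimagic_total ::
    "('a, 'b) pre_digraph \<Rightarrow> ('a + 'b \<Rightarrow> nat) \<Rightarrow> bool" where
  "vertex_antimagic_total G f \<longleftrightarrow>
     total_labeling G f \<and> inj_on (vertex_weight G f) (verts G)"

definition vertex_antimagic_total_digraph :: "('a, 'b) pre_digraph \<Rightarrow> bool" where
  "vertex_antimagic_total_digraph G \<longleftrightarrow>
     fin_digraph G \<and> (\<exists>f. vertex_antimagic_total G f)"

text \<open>
  The vertex \<open>v\<^sub>i\<close> is represented by its index \<open>i\<close>, and the unique arc
  from \<open>v\<^sub>i\<close> to \<open>v\<^sub>j\<close> for \<open>i < j\<close> by the pair \<open>(i, j)\<close>.
\<close>

definition directed_K :: "nat \<Rightarrow> (nat, nat \<times> nat) pre_digraph" where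
  "directed_K n =
     \<lparr> verts = {1..n},
       arcs = {(i, j). 1 \<le> i \<and> i < j \<and> j \<le> n},
       tail = fst,
       head = snd \<rparr>"

lemma digraph_directed_K: "digraph (directed_K n)"
proof -
  have "arcs (directed_K n) \<subseteq> {1..n} \<times> {1..n}"
    by (auto simp: directed_K_def)
  then have "finite (arcs (directed_K n))"
    by (rule finite_subset) simp
  then show ?thesis
    by unfold_locales (auto simp: directed_K_def arc_to_ends_def)
qed

lemma card_verts_directed_K: "card (verts (directed_K n)) = n"
  by (simp add: directed_K_def)

lemma card_arcs_directed_K: "card (arcs (directed_K n)) = n choose 2"
proof (induction n)
  case 0
  have "arcs (directed_K 0) = {}"
    by (auto simp: directed_K_def)
  then show ?case by simp
next
  case (Suc n)
  have eq: "arcs (directed_K (Suc n)) = arcs (directed_K n) \<union> (\<lambda>i. (i, Suc n)) ` {1..n}"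
    by (auto simp: directed_K_def)
  have "finite (arcs (directed_K n))"
    using digraph_directed_K[of n]
    by (simp add: digraph_def fin_digraph.finite_arcs)
  moreover have "arcs (directed_K n) \<inter> (\<lambda>i. (i, Suc n)) ` {1..n} = {}"
    by (auto simp: directed_K_def)
  moreover have "card ((\<lambda>i. (i, Suc n)) ` {1..n}) = n"
    by (subst card_image) (auto simp: inj_on_def)
  ultimately show ?case
    using Suc.IH by (simp add: eq card_Un_disjoint numeral_2_eq_2)
qed

end

theory Submission
  imports Defs
begin

text \<open>
  Label the arcs arbitrarily with the largest labels, and give the smallest labels to the vertices
  in an order in which the arc sums at the vertices do not decrease. Then the vertex weights
  increase strictly along this order. The argument applies to every finite digraph.
\<close>

text \<open>Ranking induction adds elements in nondecreasing order of \<open>s\<close>. Each new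
  element has maximal \<open>s\<close> so far, so giving it the next free number keeps the
  enumeration monotone.\<close>

lemma ex_monotone_enumeration:
  fixes s :: "'a \<Rightarrow> 'b::linorder"
  assumes "finite A"
  shows "\<exists>h. bij_betw h A {1..card A} \<and> (\<forall>u\<in>A. \<forall>v\<in>A. h u < h v \<longrightarrow> s u \<le> s v)"
  using assms
proof (induction A rule: finite_ranking_induct[where f = s])
  case empty
  show ?case by (simp add: bij_betw_def)
next
  case (insert x A)
  show ?case
  \<comment> \<open>The ranking induction does not guarantee that \<open>x\<close> is new; a
    repeated element leaves the set unchanged.\<close>
  proof (cases "x \<in> A")
    case True
    then show ?thesis
      using insert.IH by (simp add: insert_absorb)
  next
    case False
    obtain h where bij: "bij_betw h A {1..card A}"
      and mono: "\<forall>u\<in>A. \<forall>v\<in>A. h u < h v \<longrightarrow> s u \<le> s v"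
      using insert.IH by blast
    let ?h = "h(x := Suc (card A))"
    have "bij_betw ?h A {1..card A}"
      using bij False by (subst bij_betw_cong[of A ?h h]) auto
    then have "bij_betw ?h (A \<union> {x}) ({1..card A} \<union> {?h x})"
      using False by (intro notIn_Un_bij_betw) auto
    moreover have "{1..card A} \<union> {?h x} = {1..card (insert x A)}"
      using False insert.hyps by auto
    ultimately have "bij_betw ?h (insert x A) {1..card (insert x A)}"
      by simp
    moreover have "s u \<le> s v"
      if uv: "u \<in> insert x A" "v \<in> insert x A" "?h u < ?h v" for u v
    proof (cases "v = x")
      case True
      then show ?thesis
        using uv(1) insert.hyps by auto
    next
      case v: False
      \<comment> \<open>The label \<open>Suc (card A)\<close> of \<open>x\<close> exceeds every old
        label, so \<open>x\<close> cannot be the element with the smaller label.\<close>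
      then have "h v \<le> card A"
        using bij_betwE[OF bij] uv(2) by auto
      then have "u \<noteq> x"
        using uv(3) v by auto
      then show ?thesis
        using mono uv v by simp
    qed
    ultimately show ?thesis by blast
  qed
qed

lemma (in fin_digraph) vertex_antimagic_total_digraph:
  "vertex_antimagic_total_digraph G"
proof -
  let ?n = "card (verts G)" and ?m = "card (arcs G)"
  obtain g where g: "bij_betw g (arcs G) {?n + 1..?n + ?m}"
    using finite_same_card_bij[of "arcs G" "{?n + 1..?n + ?m}"] finite_arcs by auto
  \<comment> \<open>With the arc labels fixed first, \<open>s\<close> does not depend on the vertex
    labels, so these may be chosen according to \<open>s\<close>.\<close>
  define s where "s v = (\<Sum>e\<in>in_arcs G v. g e) + (\<Sum>e\<in>out_arcs G v. g e)" for v
  obtain h where h: "bij_betw h (verts G) {1..?n}"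
    and mono: "\<And>u v. u \<in> verts G \<Longrightarrow> v \<in> verts G \<Longrightarrow> h u < h v \<Longrightarrow> s u \<le> s v"
    using ex_monotone_enumeration[OF finite_verts, of s] by blast
  let ?f = "case_sum h g"
  have weight: "vertex_weight G ?f v = h v + s v" for v
    by (simp add: vertex_weight_def s_def)
  have "bij_betw ?f (Inl ` verts G) {1..?n}" "bij_betw ?f (Inr ` arcs G) {?n + 1..?n + ?m}"
    using h g by (auto simp: bij_betw_def inj_on_def image_image)
  then have "bij_betw ?f (verts G <+> arcs G) ({1..?n} \<union> {?n + 1..?n + ?m})"
    unfolding Plus_def by (rule bij_betw_combine) auto
  moreover have "{1..?n} \<union> {?n + 1..?n + ?m} = {1..?n + ?m}"
    by auto
  ultimately have "total_labeling G ?f"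
    by (simp add: total_labeling_def)
  moreover have "inj_on (vertex_weight G ?f) (verts G)"
  proof (rule inj_onI)
    fix u v
    assume uv: "u \<in> verts G" "v \<in> verts G" "vertex_weight G ?f u = vertex_weight G ?f v"
    \<comment> \<open>If \<open>h u < h v\<close>, then \<open>s u \<le> s v\<close> makes the
      weight of \<open>u\<close> strictly smaller; the reverse case is symmetric.\<close>
    then have "h u = h v"
      using mono[of u v] mono[of v u] by (cases "h u" "h v" rule: linorder_cases) (auto simp: weight)
    then show "u = v"
      using h uv by (auto simp: bij_betw_def dest: inj_onD)
  qed
  ultimately show ?thesis
    using fin_digraph_axioms
    by (auto simp: vertex_antimagic_total_digraph_def vertex_antimagic_total_def)
qed

theorem theorem3:
  fixes n :: nat
  assumes "n \<ge> 3"
  shows "vertex_antimagic_total_digraph (directed_K n)"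
proof -
  interpret digraph "directed_K n"
    by (rule digraph_directed_K)
  show ?thesis
    by (rule vertex_antimagic_total_digraph)
qed

end
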